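(* Let $s_m$ be the maximum inventory level at which it is optimal to place an order (see context), let $$G^B_n(x)= K-vx+G_n(x+B),\qquad G^S_n(x)= K-vx+\min_{x\leq y \leq x+B} G_n(y),$$ $$s= \inf\Big\{x : K+\min_{x\leq y \leq x+B} G_n(y) - G_n(x)\geq 0\Big\}.$$ Then $$C_n(x)=\begin{cases} G^B_n(x) & x< s_m-B,\\ G^S_n(x) & s_m-B \leq x < s,\\ \min\{-vx+G_n(x),\,G^S_n(x)\} & s \leq x \leq s_m,\\ -vx+G_n(x) & x> s_m. \end{cases}$$
   Context: Model: a periodic-review single-item inventory system with finite horizon; periods are labelled in reverse order, so $C_n$ refers to a horizon of $n\ge 1$ periods. Demands $d_t\ge 0$ are independent, with finite mean, density $f_t$ and cumulative distribution function $F_t$. Unmet demand is backordered, lead time is zero. Parameters: fixed ordering cost $K>0$, unit ordering cost $v\ge 0$, unit holding cost $h>0$, unit shortage cost $p>0$, ordering capacity $B>0$ per period. Ordering cost: $c(0)=0$ and $c(x)=K+vx$ for $x>0$. One-period expected holding/shortage cost: $L_n(y)=\int_0^y h(y-\xi)f_n(\xi)\,d\xi+\int_y^\infty p(\xi-y)f_n(\xi)\,d\xi$ (with $f_n=0$ on negative arguments). Define $C_0\equiv 0$ and, for $n\ge1$, $$C_n(x)=\min_{x\le y\le x+B}\Big\{c(y-x)+L_n(y)+\int_0^\infty C_{n-1}(y-\xi)f_n(\xi)\,d\xi\Big\},\quad G_n(y)=vy+L_n(y)+\int_0^\infty C_{n-1}(y-\xi)f_n(\xi)\,d\xi,$$ so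 that $C_n(x)=-vx+\min\{G_n(x),\,K+\min_{x\le y\le x+B}G_n(y)\}$. A function $g$ is $(K,B)$-convex if both of the following hold: (i) $(K+g(x+a)-g(x))/a\ge (g(y)-g(y-b))/b$ for all $0<a\le B$, $0<b\le B$, $y\le x$; (ii) $(K+g(x+a)-g(x))/a\ge (K+g(y)-g(y-B))/B$ for all $0<a\le B$, $y\le x$. It is a known fact (usable here) that $G_n$ and $C_n$ are $(K,B)$-convex. It is optimal to place an order at $x$ if $K+\min_{x\le y\le x+B}G_n(y)\le G_n(x)$. $s_m$ denotes the maximum inventory level at which it is optimal to place an order, assumed to exist as a finite number. *)

theory Defs
  imports "HOL-Probability.Probability"
begin

record inventory =
  fixed_cost :: real
  unit_cost :: real
  holding_cost :: real
  shortage_cost :: real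
  capacity :: real
  demand_density :: "nat \<Rightarrow> real \<Rightarrow> real"

text \<open>
  Periods are labelled in reverse order: period \<open>t\<close> is the one with \<open>t\<close> periods to go, and the
  horizon has \<open>N\<close> periods \<open>1, \<dots>, N\<close>. The demand in period \<open>t\<close> is the random variable \<open>d t\<close>.
\<close>

locale inventory_model = prob_space M
  for M :: "'a measure" +
  fixes d :: "nat \<Rightarrow> 'a \<Rightarrow> real"
    and I :: inventory
    and N :: nat
  assumes fixed_cost_pos: "0 < fixed_cost I"
    and unit_cost_nonneg: "0 \<le> unit_cost I"
    and holding_cost_pos: "0 < holding_cost I"
    and shortage_cost_pos: "0 < shortage_cost I"
    and capacity_pos: "0 < capacity I"
    and demand_nonneg: "\<And>t. t \<in> {1..N} \<Longrightarrow> AE \<omega> in M. 0 \<le> d t \<omega>"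
    and demand_indep: "indep_vars (\<lambda>_. borel) d {1..N}"
    and demand_finite_mean: "\<And>t. t \<in> {1..N} \<Longrightarrow> integrable M (d t)"
    and demand_distributed:
      "\<And>t. t \<in> {1..N} \<Longrightarrow> distributed M lborel (d t) (\<lambda>\<xi>. ennreal (demand_density I t \<xi>))"
    and density_nonneg: "\<And>t \<xi>. t \<in> {1..N} \<Longrightarrow> 0 \<le> demand_density I t \<xi>"
    and density_neg: "\<And>t \<xi>. t \<in> {1..N} \<Longrightarrow> \<xi> < 0 \<Longrightarrow> demand_density I t \<xi> = 0"

text \<open>Only used for \<open>z \<ge> 0\<close>.\<close>

definition order_cost :: "inventory \<Rightarrow> real \<Rightarrow> real" where
  "order_cost I z = (if z = 0 then 0 else fixed_cost I + unit_cost I * z)"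

text \<open>
  For \<open>y < 0\<close> the interval of the first integral is empty, in agreement with the oriented
  integral from \<open>0\<close> to \<open>y\<close> of a function that vanishes on the negative half-line.
\<close>

definition period_cost :: "inventory \<Rightarrow> nat \<Rightarrow> real \<Rightarrow> real" where
  "period_cost I n y =
     (LBINT \<xi>:{0..y}. holding_cost I * (y - \<xi>) * demand_density I n \<xi>)
     + (LBINT \<xi>:{y..}. shortage_cost I * (\<xi> - y) * demand_density I n \<xi>)"

text \<open>
  All minima over \<open>{x..x + B}\<close> are written as infima. In an \<open>inventory_model\<close> they are attained:
  the functions \<open>G\<close> are continuous, and \<open>order_cost\<close> is lower semicontinuous on \<open>[0, B]\<close>.
\<close>

primrec opt_cost :: "inventory \<Rightarrow> nat \<Rightarrow> real \<Rightarrow> real" where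
  "opt_cost I 0 x = 0"
| "opt_cost I (Suc n) x =
     (INF y\<in>{x..x + capacity I}.
        order_cost I (y - x) + period_cost I (Suc n) y
        + (LBINT \<xi>:{0..}. opt_cost I n (y - \<xi>) * demand_density I (Suc n) \<xi>))"

text \<open>The functions \<open>G\<close>, \<open>G\<^sup>B\<close> and \<open>G\<^sup>S\<close>; meaningful for \<open>n \<ge> 1\<close>.\<close>

definition cost_G :: "inventory \<Rightarrow> nat \<Rightarrow> real \<Rightarrow> real" where
  "cost_G I n y = unit_cost I * y + period_cost I n y
     + (LBINT \<xi>:{0..}. opt_cost I (n - 1) (y - \<xi>) * demand_density I n \<xi>)"

definition min_G :: "inventory \<Rightarrow> nat \<Rightarrow> real \<Rightarrow> real" where
  "min_G I n x = (INF y\<in>{x..x + capacity I}. cost_G I n y)"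

definition cost_GB :: "inventory \<Rightarrow> nat \<Rightarrow> real \<Rightarrow> real" where
  "cost_GB I n x = fixed_cost I - unit_cost I * x + cost_G I n (x + capacity I)"

definition cost_GS :: "inventory \<Rightarrow> nat \<Rightarrow> real \<Rightarrow> real" where
  "cost_GS I n x = fixed_cost I - unit_cost I * x + min_G I n x"

definition order_optimal :: "inventory \<Rightarrow> nat \<Rightarrow> real \<Rightarrow> bool" where
  "order_optimal I n x \<longleftrightarrow> fixed_cost I + min_G I n x \<le> cost_G I n x"

definition is_max_order_level :: "inventory \<Rightarrow> nat \<Rightarrow> real \<Rightarrow> bool" where
  "is_max_order_level I n s_m \<longleftrightarrow>
     order_optimal I n s_m \<and> (\<forall>x. order_optimal I n x \<longrightarrow> x \<le> s_m)"

text \<open>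
  The infimum is taken in the extended reals because it can be \<open>-\<infinity>\<close> even when the maximum order
  level exists. For instance, if \<open>n = 1\<close> and \<open>K = B * (p - v)\<close>, then \<open>G\<close> is affine with slope
  \<open>v - p\<close> on the negative half-line, so ordering and not ordering cost the same at
  every \<open>x \<le> - B\<close>.
\<close>

definition reorder_level :: "inventory \<Rightarrow> nat \<Rightarrow> ereal" where
  "reorder_level I n =
     Inf (ereal ` {x. fixed_cost I + min_G I n x - cost_G I n x \<ge> 0})"

end

theory Submission
  imports Defs
begin

text \<open>
  If ordering is optimal at \<open>x\<close>, a minimiser \<open>x + a\<close> of \<open>G\<close> on the order window makes the quotient
  \<open>(K + G (x + a) - G x) / a\<close> nonpositive, so the two conditions of \<open>(K, B)\<close>-convexity say that \<open>G\<close>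
  is antitone on the half-line below \<open>x\<close> and that a full order of size \<open>B\<close> ending there always pays
  for its fixed cost. Taking \<open>x = s_m\<close> gives the first case of the formula; the others only compare
  the cost of ordering with the cost of not ordering.

  That \<open>G\<^sub>n\<close> is \<open>(K, B)\<close>-convex is shown by induction on \<open>n\<close>, together with Lipschitz continuity,
  which guarantees that the minima are attained and the expectations finite.
\<close>

section \<open>\<open>(K, B)\<close>-convexity\<close>

text \<open>The defining inequalities are cleared of denominators, so that they are linear in \<open>g\<close>.\<close>

definition KB_convex :: "real \<Rightarrow> real \<Rightarrow> (real \<Rightarrow> real) \<Rightarrow> bool" where
  "KB_convex K B g \<longleftrightarrow>
     (\<forall>x y a b. 0 < a \<longrightarrow> a \<le> B \<longrightarrow> 0 < b \<longrightarrow> b \<le> B \<longrightarrow> y \<le> x \<longrightarrow>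
        a * (g y - g (y - b)) \<le> b * (K + g (x + a) - g x)) \<and>
     (\<forall>x y a. 0 < a \<longrightarrow> a \<le> B \<longrightarrow> y \<le> x \<longrightarrow>
        a * (K + g y - g (y - B)) \<le> B * (K + g (x + a) - g x))"

lemma KB_convexI:
  assumes "\<And>x y a b. \<lbrakk>0 < a; a \<le> B; 0 < b; b \<le> B; y \<le> x\<rbrakk> \<Longrightarrow>
      a * (g y - g (y - b)) \<le> b * (K + g (x + a) - g x)"
    and "\<And>x y a. \<lbrakk>0 < a; a \<le> B; y \<le> x\<rbrakk> \<Longrightarrow>
      a * (K + g y - g (y - B)) \<le> B * (K + g (x + a) - g x)"
  shows "KB_convex K B g"
  using assms unfolding KB_convex_def by blast

lemma KB_convexD1:
  assumes "KB_convex K B g" "0 < a" "a \<le> B" "0 < b" "b \<le> B" "y \<le> x"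
  shows "a * (g y - g (y - b)) \<le> b * (K + g (x + a) - g x)"
  using assms unfolding KB_convex_def by blast

lemma KB_convexD2:
  assumes "KB_convex K B g" "0 < a" "a \<le> B" "y \<le> x"
  shows "a * (K + g y - g (y - B)) \<le> B * (K + g (x + a) - g x)"
  using assms unfolding KB_convex_def by blast

text \<open>Both conditions are linear in the pair \<open>(K, g)\<close>. Two separate constants
  allow a summand with constant \<open>0\<close> to be added while \<open>K\<close> stays as it
  is.\<close>

lemma KB_convex_add:
  assumes f: "KB_convex K B f" and g: "KB_convex L B g"
  shows "KB_convex (K + L) B (\<lambda>x. f x + g x)"
proof (rule KB_convexI)
  fix x y a b :: real
  assume *: "0 < a" "a \<le> B" "0 < b" "b \<le> B" "y \<le> x"
  show "a * (f y + g y - (f (y - b) + g (y - b)))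
      \<le> b * (K + L + (f (x + a) + g (x + a)) - (f x + g x))"
    using KB_convexD1[OF f *] KB_convexD1[OF g *] by (simp add: algebra_simps)
next
  fix x y a :: real
  assume *: "0 < a" "a \<le> B" "y \<le> x"
  show "a * (K + L + (f y + g y) - (f (y - B) + g (y - B)))
      \<le> B * (K + L + (f (x + a) + g (x + a)) - (f x + g x))"
    using KB_convexD2[OF f *] KB_convexD2[OF g *] by (simp add: algebra_simps)
qed

lemma KB_convex_linear: "KB_convex 0 B (\<lambda>x. c * x)"
  by (rule KB_convexI) (simp_all add: algebra_simps)

lemma KB_convex_const:
  assumes "0 \<le> K"
  shows "KB_convex K B (\<lambda>x. c)"
  by (rule KB_convexI) (use assms in \<open>auto intro: mult_right_mono\<close>)

text \<open>All slopes lie between \<open>-p\<close> and \<open>h\<close>. For \<open>0 <= x\<close>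
  the slope to the right of \<open>x\<close> is exactly \<open>h\<close>; for \<open>x < 0\<close>
  the slope to the left of \<open>y <= x\<close> is exactly \<open>-p\<close>. With constant
  \<open>0\<close> the second condition is the first one at \<open>b = B\<close>.\<close>

lemma KB_convex_piecewise_linear:
  assumes "0 \<le> h" "0 \<le> p"
  shows "KB_convex 0 B (\<lambda>u. h * max u 0 + p * max (- u) 0)" (is "KB_convex 0 B ?l")
proof -
  have upper: "?l u - ?l w \<le> h * (u - w)" and lower: "- p * (u - w) \<le> ?l u - ?l w"
    if "w \<le> u" for u w
    using that assms mult_left_mono[of w u h] mult_left_mono[of w u p]
      mult_nonneg_nonneg[of h u] mult_nonneg_nonneg[of p u]
      mult_nonneg_nonneg[of h "-w"] mult_nonneg_nonneg[of p "-w"]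
    by (auto simp: max_def algebra_simps)
  have 1: "a * (?l y - ?l (y - b)) \<le> b * (?l (x + a) - ?l x)"
    if *: "0 < a" "0 < b" "y \<le> x" for x y a b
  proof (cases "0 \<le> x")
    case True
    then have "?l (x + a) - ?l x = h * a"
      using that by (simp add: max_def algebra_simps)
    moreover have "a * (?l y - ?l (y - b)) \<le> a * (h * b)"
      using upper[of "y - b" y] that by (intro mult_left_mono) auto
    ultimately show ?thesis
      by (simp only: mult.left_commute mult.commute)
  next
    case False
    then have "?l y - ?l (y - b) = - p * b"
      using that by (simp add: max_def algebra_simps)
    moreover have "b * (- p * a) \<le> b * (?l (x + a) - ?l x)"
      using lower[of x "x + a"] that by (intro mult_left_mono) auto
    ultimately show ?thesis
      by (simp only: mult.left_commute mult.commute)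
  qed
  show ?thesis
    by (rule KB_convexI; unfold add_0; rule 1) auto
qed

text \<open>The hypothesis on \<open>x\<close> says that ordering \<open>c\<close> units at \<open>x\<close> is at least as good as not ordering.\<close>

lemma KB_convex_below_order_point:
  assumes g: "KB_convex K B g" and B: "0 < B"
    and c: "0 < c" "c \<le> B" "K + g (x + c) \<le> g x" and y: "y \<le> x"
  shows "K + g y \<le> g (y - B)" and "w \<le> y \<Longrightarrow> g y \<le> g w"
proof -
  have "c * (K + g y - g (y - B)) \<le> B * (K + g (x + c) - g x)"
    using KB_convexD2[OF g c(1,2) y] .
  also have "\<dots> \<le> 0"
    using B c(3) by (simp add: mult_le_0_iff)
  finally show "K + g y \<le> g (y - B)"
    using c(1) by (simp add: mult_le_0_iff)
  have step: "g u \<le> g (u - b)" if "u \<le> x" "0 < b" "b \<le> B" for u b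
  proof -
    have "c * (g u - g (u - b)) \<le> b * (K + g (x + c) - g x)"
      using KB_convexD1[OF g c(1,2) that(2,3,1)] .
    also have "\<dots> \<le> 0"
      using that c(3) by (simp add: mult_le_0_iff)
    finally show ?thesis
      using c(1) by (simp add: mult_le_0_iff)
  qed
  have steps: "g y \<le> g (y - real n * b)" if "0 < b" "b \<le> B" for n b
  proof (induction n)
    case (Suc n)
    have "y - real n * b \<le> x"
      using y that by (simp add: diff_le_eq add_increasing2)
    from step[OF this that] Suc show ?case
      by (simp add: algebra_simps)
  qed simp
  show "g y \<le> g w" if "w \<le> y"
  proof (cases "w = y")
    case False
    \<comment> \<open>The distance from \<open>w\<close> to \<open>y\<close> may exceed
      \<open>B\<close>, so it is cut into \<open>n\<close> equal steps of length at most
      \<open>B\<close>.\<close>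
    obtain n where n: "(y - w) / B < real n"
      using reals_Archimedean2 by blast
    have "0 < (y - w) / B"
      using False that B by simp
    then have "0 < real n"
      using n by linarith
    then have "0 < (y - w) / n" "(y - w) / n \<le> B" "real n * ((y - w) / n) = y - w"
      using n False that B by (auto simp: field_simps)
    then show ?thesis
      using steps[of "(y - w) / n" n] by simp
  qed simp
qed

section \<open>Minima over a sliding window\<close>

definition window_min :: "real \<Rightarrow> (real \<Rightarrow> real) \<Rightarrow> real \<Rightarrow> real" where
  "window_min B g x = (INF y\<in>{x..x + B}. g y)"

lemma window_min_attained:
  fixes g :: "real \<Rightarrow> real"
  assumes "continuous_on UNIV g" "0 \<le> B"
  obtains z where "z \<in> {x..x + B}" "window_min B g x = g z" "\<And>y. y \<in> {x..x + B} \<Longrightarrow> g z \<le> g y"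
proof -
  have "continuous_on {x..x + B} g"
    using assms(1) continuous_on_subset by blast
  with assms(2) obtain z where z: "z \<in> {x..x + B}" "\<And>y. y \<in> {x..x + B} \<Longrightarrow> g z \<le> g y"
    using continuous_attains_inf[of "{x..x + B}" g] by auto
  moreover have "window_min B g x = g z"
    unfolding window_min_def by (rule cInf_eq_minimum) (use z in auto)
  ultimately show ?thesis
    using that by blast
qed

lemma window_min_le:
  fixes g :: "real \<Rightarrow> real"
  assumes "continuous_on UNIV g" "y \<in> {x..x + B}"
  shows "window_min B g x \<le> g y"
  using window_min_attained[OF assms(1), of B x] assms(2) by (metis atLeastAtMost_iff
      add_le_cancel_left add_0_right order_trans)

text \<open>Moving a minimiser along with its window changes \<open>g\<close> by at most
  \<open>L\<close> times the shift; exchanging the two windows gives the other inequality.\<close>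

lemma lipschitz_on_window_min:
  fixes g :: "real \<Rightarrow> real"
  assumes g: "L-lipschitz_on UNIV g" and "0 \<le> B"
  shows "L-lipschitz_on UNIV (window_min B g)"
proof (rule lipschitz_onI)
  have cont: "continuous_on UNIV g"
    using g by (rule lipschitz_on_continuous_on)
  have le: "window_min B g x \<le> window_min B g y + L * dist x y" for x y
  proof -
    obtain z where z: "z \<in> {y..y + B}" "window_min B g y = g z"
      using window_min_attained[OF cont \<open>0 \<le> B\<close>, of y] by metis
    have "window_min B g x \<le> g (z + (x - y))"
      by (rule window_min_le[OF cont]) (use z(1) in auto)
    also have "\<dots> \<le> g z + L * dist x y"
      using lipschitz_onD[OF g, of "z + (x - y)" z] by (simp add: dist_real_def)
    finally show ?thesis
      using z(2) by simp
  qed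
  show "dist (window_min B g x) (window_min B g y) \<le> L * dist x y" for x y
    using le[of x y] le[of y x] by (simp only: dist_commute[of y x]) (simp add: dist_real_def abs_le_iff)
  show "0 \<le> L"
    using g by (rule lipschitz_on_nonneg)
qed

lemma lipschitz_on_min:
  fixes f g :: "real \<Rightarrow> real"
  assumes f: "L-lipschitz_on UNIV f" and g: "L-lipschitz_on UNIV g"
  shows "L-lipschitz_on UNIV (\<lambda>x. min (f x) (g x))"
proof (rule lipschitz_onI)
  show "dist (min (f x) (g x)) (min (f y) (g y)) \<le> L * dist x y" for x y
    using lipschitz_onD[OF f, of x y] lipschitz_onD[OF g, of x y]
    by (auto simp: dist_real_def min_def)
  show "0 \<le> L"
    using f by (rule lipschitz_on_nonneg)
qed

lemma lipschitz_on_linear: "\<bar>c\<bar>-lipschitz_on UNIV (\<lambda>x::real. c * x)"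
  by (rule lipschitz_onI) (simp_all add: dist_real_def flip: right_diff_distrib abs_mult)

section \<open>Preservation of \<open>(K, B)\<close>-convexity\<close>

text \<open>
  For nonnegative quotients on the right-hand side only the behaviour of the optimal cost \<open>H\<close> at
  \<open>y\<close> matters: below an order point \<open>H\<close> is antitone and a full order is optimal, whereas above all
  order points \<open>H = g\<close>. If the quotient at \<open>x\<close> is negative, then \<open>x + B\<close> is itself an order point, so
  that \<open>H u = K + g (u + B)\<close> for \<open>u \<le> x\<close>.
\<close>

lemma KB_convex_min_order:
  fixes g :: "real \<Rightarrow> real"
  assumes g: "KB_convex K B g" and cont: "continuous_on UNIV g" and "0 < B" "0 < K"
  shows "KB_convex K B (\<lambda>x. min (g x) (K + window_min B g x))" (is "KB_convex K B ?H")
proof -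
  \<comment> \<open>As \<open>0 < K\<close>, this amounts to optimality of ordering at
    \<open>x\<close>, in the form that \<open>KB_convex_below_order_point\<close> takes.\<close>
  define order_point where
    "order_point x \<longleftrightarrow> (\<exists>c. 0 < c \<and> c \<le> B \<and> K + g (x + c) \<le> g x)" for x
  have H_le: "?H x \<le> K + g z" if "z \<in> {x..x + B}" for x z
    using window_min_le[OF cont that] by simp
  have H_cases: "?H x = g x \<or> (order_point x \<and> (\<exists>z. x < z \<and> z \<le> x + B \<and> ?H x = K + g z))" for x
  proof (cases "g x \<le> K + window_min B g x")
    case False
    obtain z where z: "z \<in> {x..x + B}" "window_min B g x = g z"
      using window_min_attained[OF cont, of B x] \<open>0 < B\<close> by (metis less_imp_le)
    have "z \<noteq> x"
      using False z \<open>0 < K\<close> by auto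
    then have "0 < z - x" "z - x \<le> B" "K + g (x + (z - x)) \<le> g x"
      using z False by auto
    then have "order_point x"
      unfolding order_point_def by blast
    with False z \<open>z \<noteq> x\<close> show ?thesis
      by (intro disjI2 conjI exI[of _ z]) auto
  qed simp
  have full: "K + g y \<le> g (y - B)" and antitone: "w \<le> y \<Longrightarrow> g y \<le> g w"
    if "order_point t" "y \<le> t" for t y w
    using that KB_convex_below_order_point[OF g \<open>0 < B\<close>] unfolding order_point_def by blast+
  \<comment> \<open>At \<open>y - B\<close> nothing beats the full order: not ordering loses by
    \<open>full\<close>, a smaller order because \<open>g\<close> is antitone below
    \<open>t\<close>.\<close>
  have H_full: "?H (y - B) = K + g y" if "order_point t" "y \<le> t" for t y
  proof -
    have "K + g y \<le> ?H (y - B)"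
      using H_cases[of "y - B"]
    proof
      assume "?H (y - B) = g (y - B)"
      then show ?thesis
        using full[OF that] by simp
    next
      assume "order_point (y - B) \<and> (\<exists>z. y - B < z \<and> z \<le> y - B + B \<and> ?H (y - B) = K + g z)"
      then obtain z where z: "z \<le> y" "?H (y - B) = K + g z"
        by auto
      then show ?thesis
        using antitone[OF that z(1)] by linarith
    qed
    moreover have "?H (y - B) \<le> K + g y"
      using H_le[of y "y - B"] \<open>0 < B\<close> by simp
    ultimately show ?thesis
      by (rule antisym[rotated])
  qed
  have H_antitone: "?H y \<le> ?H w" if "order_point t" "y \<le> t" "w \<le> y" for t y w
    using H_cases[of w]
  proof
    assume "?H w = g w"
    then show ?thesis
      using antitone[OF that] by linarith
  next
    assume "order_point w \<and> (\<exists>z. w < z \<and> z \<le> w + B \<and> ?H w = K + g z)"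
    then obtain z where z: "w < z" "z \<le> w + B" "?H w = K + g z"
      by auto
    \<comment> \<open>The level \<open>y\<close> does no worse than \<open>w\<close>: if
      \<open>z\<close> is already reached, not ordering suffices; otherwise \<open>z\<close> is also
      within reach from \<open>y\<close>.\<close>
    show ?thesis
    proof (cases "z \<le> y")
      case True
      have "?H y \<le> g y"
        by simp
      also have "\<dots> \<le> g z"
        using antitone[OF that(1,2) True] .
      finally show ?thesis
        using z(3) \<open>0 < K\<close> by linarith
    next
      case False
      then show ?thesis
        using H_le[of z y] z that(3) by auto
    qed
  qed
  have H_eq: "?H x = g x" if "\<not> order_point x" for x
    using H_cases[of x] that by blast
  have no_order: "g x < K + g (x + c)" if "\<not> order_point x" "0 < c" "c \<le> B" for x c
    using that unfolding order_point_def by force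

  \<comment> \<open>A negative value means that at \<open>x + a\<close> it is optimal to order up to
    some \<open>z\<close> out of reach from \<open>x\<close>, else \<open>x\<close> could copy that
    order. So \<open>z\<close> exceeds \<open>x + B\<close> by at most \<open>a\<close>, and since
    \<open>?H x <= K + g (x + B)\<close>, the order from \<open>x + B\<close> to \<open>z\<close>
    pays.\<close>
  have order_full: "\<exists>a'. 0 < a' \<and> a' \<le> a \<and> order_point (x + B)
      \<and> K + g (x + B + a') - g (x + B) \<le> K + ?H (x + a) - ?H x"
    if a: "0 < a" "a \<le> B" and neg: "K + ?H (x + a) - ?H x < 0" for a x
  proof -
    have "?H (x + a) \<noteq> g (x + a)"
      using H_le[of "x + a" x] a neg by auto
    then obtain z where z: "x + a < z" "z \<le> x + a + B" "?H (x + a) = K + g z"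
      using H_cases[of "x + a"] by blast
    have "\<not> z \<le> x + B"
      using H_le[of z x] z neg a \<open>0 < K\<close> by fastforce
    moreover have le: "K + g z - g (x + B) \<le> K + ?H (x + a) - ?H x"
      using H_le[of "x + B" x] z \<open>0 < B\<close> by auto
    then have "K + g (x + B + (z - x - B)) \<le> g (x + B)"
      using neg by argo
    ultimately have "order_point (x + B)"
      unfolding order_point_def using z a by (intro exI[of _ "z - x - B"]) auto
    then show ?thesis
      using z le \<open>\<not> z \<le> x + B\<close> by (intro exI[of _ "z - x - B"]) auto
  qed
  \<comment> \<open>Here \<open>q\<close>, \<open>q'\<close> stand for forward differences and
    \<open>r\<close> for a backward one. A negative \<open>q\<close> forces \<open>r < 0\<close>, so
    replacing \<open>a'\<close> by the larger \<open>a\<close> only lowers the left-hand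
    side.\<close>
  have shrink: "b * q' \<le> b * q \<and> a * r \<le> b * q"
    if "a' * r \<le> b * q'" "q' \<le> q" "q < 0" "0 < a'" "a' \<le> a" "0 < b" for a a' b q q' r :: real
  proof
    show *: "b * q' \<le> b * q"
      using that by simp
    have "a' * r < 0"
      using that mult_pos_neg[of b q'] by linarith
    then have "r < 0"
      using that(4) by (simp add: mult_less_0_iff)
    then have "a * r \<le> a' * r"
      using that(5) by simp
    then show "a * r \<le> b * q"
      using * that(1) by linarith
  qed

  show ?thesis
  proof (rule KB_convexI)
    fix x y a b :: real
    assume ab: "0 < a" "a \<le> B" "0 < b" "b \<le> B" and yx: "y \<le> x"
    consider (neg) "K + ?H (x + a) - ?H x < 0"
      | (below) t where "0 \<le> K + ?H (x + a) - ?H x" "order_point t" "y \<le> t"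
      | (above) "\<And>t. y \<le> t \<Longrightarrow> \<not> order_point t"
      by force
    then show "a * (?H y - ?H (y - b)) \<le> b * (K + ?H (x + a) - ?H x)"
    proof cases
      case neg
      from order_full[OF ab(1,2) neg]
      obtain a' where a': "0 < a'" "a' \<le> a" "order_point (x + B)"
        "K + g (x + B + a') - g (x + B) \<le> K + ?H (x + a) - ?H x"
        by blast
      \<comment> \<open>Full orders are optimal at \<open>y\<close> and \<open>y - b\<close>, so
        \<open>K\<close> cancels and both values become those of \<open>g\<close> shifted by
        \<open>B\<close>; the first condition for \<open>g\<close> then applies at
        \<open>x + B\<close> and \<open>y + B\<close>.\<close>
      have "?H y - ?H (y - b) = g (y + B) - g (y + B - b)"
        using H_full[OF a'(3), of "y + B"] H_full[OF a'(3), of "y + B - b"] yx ab by simp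
      moreover have "a' * (g (y + B) - g (y + B - b)) \<le> b * (K + g (x + B + a') - g (x + B))"
        by (rule KB_convexD1[OF g]) (use a' ab yx in auto)
      ultimately show ?thesis
        using shrink[of a' _ b _ _ a] a' ab neg by metis
    next
      case below
      have "a * (?H y - ?H (y - b)) \<le> 0"
        using H_antitone[OF below(2,3), of "y - b"] ab by (simp add: mult_le_0_iff)
      also have "0 \<le> b * (K + ?H (x + a) - ?H x)"
        using below(1) ab by simp
      finally show ?thesis .
    next
      case above
      have eq: "?H y = g y" "?H x = g x" "?H (x + a) = g (x + a)"
        using above yx ab by (auto intro!: H_eq)
      have pos: "0 < K + g (x + a) - g x"
        using no_order[OF above[OF yx] ab(1,2)] by simp
      from H_cases[of "y - b"] show ?thesis
      proof
        assume "?H (y - b) = g (y - b)"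
        then show ?thesis
          unfolding eq using KB_convexD1[OF g ab yx] by simp
      next
        assume "order_point (y - b) \<and> (\<exists>z. y - b < z \<and> z \<le> y - b + B \<and> ?H (y - b) = K + g z)"
        then obtain z where z: "y - b < z" "z \<le> y - b + B" "?H (y - b) = K + g z"
          by blast
        \<comment> \<open>If the order from \<open>y - b\<close> reaches \<open>y\<close> or beyond,
          \<open>y\<close> may order up to \<open>z\<close> too and the left-hand side is
          nonpositive. Otherwise dropping \<open>K\<close> leaves a backward step
          \<open>y - z <= b\<close> of \<open>g\<close>, and the positive factor on the right allows
          enlarging it to \<open>b\<close>.\<close>
        show ?thesis
        proof (cases "y \<le> z")
          case True
          have "g y \<le> K + g z"
            using H_le[of z y] eq(1) z(2) True ab by auto
          then have "a * (g y - (K + g z)) \<le> 0"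
            using ab by (simp add: mult_le_0_iff)
          also have "0 \<le> b * (K + g (x + a) - g x)"
            using pos ab by simp
          finally show ?thesis
            unfolding eq z(3) .
        next
          case False
          have "a * (g y - (K + g z)) \<le> a * (g y - g (y - (y - z)))"
            using ab \<open>0 < K\<close> by simp
          also have "\<dots> \<le> (y - z) * (K + g (x + a) - g x)"
            by (rule KB_convexD1[OF g]) (use ab z False yx in auto)
          also have "\<dots> \<le> b * (K + g (x + a) - g x)"
            using z pos by (intro mult_right_mono) auto
          finally show ?thesis
            unfolding eq z(3) .
        qed
      qed
    qed
  next
    fix x y a :: real
    assume a: "0 < a" "a \<le> B" and yx: "y \<le> x"
    consider (neg) "K + ?H (x + a) - ?H x < 0"
      | (below) t where "0 \<le> K + ?H (x + a) - ?H x" "order_point t" "y \<le> t"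
      | (above) "\<And>t. y \<le> t \<Longrightarrow> \<not> order_point t"
      by force
    then show "a * (K + ?H y - ?H (y - B)) \<le> B * (K + ?H (x + a) - ?H x)"
    proof cases
      case neg
      from order_full[OF a neg]
      obtain a' where a': "0 < a'" "a' \<le> a" "order_point (x + B)"
        "K + g (x + B + a') - g (x + B) \<le> K + ?H (x + a) - ?H x"
        by blast
      have "K + ?H y - ?H (y - B) = K + g (y + B) - g (y + B - B)"
        using H_full[OF a'(3), of "y + B"] H_full[OF a'(3), of y] yx \<open>0 < B\<close> by simp
      moreover have "a' * (K + g (y + B) - g (y + B - B))
          \<le> B * (K + g (x + B + a') - g (x + B))"
        by (rule KB_convexD2[OF g]) (use a' a yx in auto)
      ultimately show ?thesis
        using shrink[of a' _ B _ _ a] a' \<open>0 < B\<close> neg by metis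
    next
      case below
      have "?H y \<le> g y"
        by simp
      then have "a * (K + ?H y - ?H (y - B)) \<le> 0"
        using H_full[OF below(2,3)] a by (simp add: mult_le_0_iff)
      also have "0 \<le> B * (K + ?H (x + a) - ?H x)"
        using below(1) \<open>0 < B\<close> by simp
      finally show ?thesis .
    next
      case above
      have eq: "?H y = g y" "?H x = g x" "?H (x + a) = g (x + a)"
        using above yx a by (auto intro!: H_eq)
      have pos: "0 < K + g (x + a) - g x"
        using no_order[OF above[OF yx] a] by simp
      from H_cases[of "y - B"] show ?thesis
      proof
        assume "?H (y - B) = g (y - B)"
        then show ?thesis
          unfolding eq using KB_convexD2[OF g a yx] by simp
      next
        assume "order_point (y - B) \<and> (\<exists>z. y - B < z \<and> z \<le> y - B + B \<and> ?H (y - B) = K + g z)"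
        then obtain z where z: "y - B < z" "z \<le> y" "?H (y - B) = K + g z"
          by auto
        \<comment> \<open>The fixed cost of the order placed at \<open>y - B\<close> cancels the
          \<open>K\<close> on the left; what remains is a backward step of length below
          \<open>B\<close>, a matter for the first condition.\<close>
        have "a * (g y - g z) \<le> B * (K + g (x + a) - g x)"
        proof (cases "z = y")
          case True
          then show ?thesis
            using pos \<open>0 < B\<close> by simp
        next
          case False
          have "a * (g y - g (y - (y - z))) \<le> (y - z) * (K + g (x + a) - g x)"
            by (rule KB_convexD1[OF g]) (use a z False yx in auto)
          also have "\<dots> \<le> B * (K + g (x + a) - g x)"
            using z pos by (intro mult_right_mono) auto
          finally show ?thesis
            by simp
        qed
        then show ?thesis
          unfolding eq z(3) by simp
      qed
    qed
  qed
qed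

section \<open>Expectations over a random shift\<close>

context prob_space
begin

text \<open>A Lipschitz function grows at most linearly, so the finite mean of \<open>X\<close> is
  enough.\<close>

lemma integrable_lipschitz_shift:
  fixes X :: "'a \<Rightarrow> real" and \<phi> :: "real \<Rightarrow> real"
  assumes X: "integrable M X" and \<phi>: "L-lipschitz_on UNIV \<phi>"
  shows "integrable M (\<lambda>\<omega>. \<phi> (y - X \<omega>))"
proof (rule Bochner_Integration.integrable_bound)
  show "integrable M (\<lambda>\<omega>. \<bar>\<phi> y\<bar> + L * \<bar>X \<omega>\<bar>)"
    using X by simp
  have "continuous_on UNIV \<phi>"
    using \<phi> by (rule lipschitz_on_continuous_on)
  then have "\<phi> \<in> borel_measurable borel"
    by (rule borel_measurable_continuous_onI)
  moreover have "(\<lambda>\<omega>. y - X \<omega>) \<in> borel_measurable M"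
    using X by simp
  ultimately show "(\<lambda>\<omega>. \<phi> (y - X \<omega>)) \<in> borel_measurable M"
    by (rule measurable_compose_rev)
  have "\<bar>\<phi> (y - t)\<bar> \<le> \<bar>\<phi> y\<bar> + L * \<bar>t\<bar>" for t
    using lipschitz_onD[OF \<phi>, of "y - t" y] by (simp add: dist_real_def)
  then show "AE \<omega> in M. norm (\<phi> (y - X \<omega>)) \<le> norm (\<bar>\<phi> y\<bar> + L * \<bar>X \<omega>\<bar>)"
    by (smt (verit) AE_I2 real_norm_def)
qed

lemma lipschitz_on_expectation_shift:
  fixes X :: "'a \<Rightarrow> real" and \<phi> :: "real \<Rightarrow> real"
  assumes X: "integrable M X" and \<phi>: "L-lipschitz_on UNIV \<phi>"
  shows "L-lipschitz_on UNIV (\<lambda>y. expectation (\<lambda>\<omega>. \<phi> (y - X \<omega>)))"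
proof (rule lipschitz_onI)
  note int = integrable_lipschitz_shift[OF X \<phi>]
  have le: "expectation (\<lambda>\<omega>. \<phi> (x - X \<omega>)) \<le> expectation (\<lambda>\<omega>. \<phi> (y - X \<omega>)) + L * dist x y"
    for x y
  proof -
    have "expectation (\<lambda>\<omega>. \<phi> (x - X \<omega>)) \<le> expectation (\<lambda>\<omega>. \<phi> (y - X \<omega>) + L * dist x y)"
    proof (intro integral_mono Bochner_Integration.integrable_add int integrable_const)
      show "\<phi> (x - X \<omega>) \<le> \<phi> (y - X \<omega>) + L * dist x y" for \<omega>
        using lipschitz_onD[OF \<phi>, of "x - X \<omega>" "y - X \<omega>"] by (simp add: dist_real_def)
    qed
    also have "\<dots> = expectation (\<lambda>\<omega>. \<phi> (y - X \<omega>)) + L * dist x y"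
      using int by (simp add: prob_space)
    finally show ?thesis .
  qed
  show "dist (expectation (\<lambda>\<omega>. \<phi> (x - X \<omega>))) (expectation (\<lambda>\<omega>. \<phi> (y - X \<omega>))) \<le> L * dist x y"
    for x y
    using le[of x y] le[of y x] by (simp only: dist_commute[of y x]) (simp add: dist_real_def abs_le_iff)
  show "0 \<le> L"
    using \<phi> by (rule lipschitz_on_nonneg)
qed

text \<open>Both conditions are translation invariant and linear in the function, so they can be
  averaged; total mass 1 keeps the constant at \<open>K\<close>.\<close>

lemma KB_convex_expectation_shift:
  fixes X :: "'a \<Rightarrow> real" and \<phi> :: "real \<Rightarrow> real"
  assumes int: "\<And>y. integrable M (\<lambda>\<omega>. \<phi> (y - X \<omega>))" and \<phi>: "KB_convex K B \<phi>"
  shows "KB_convex K B (\<lambda>y. expectation (\<lambda>\<omega>. \<phi> (y - X \<omega>)))" (is "KB_convex K B ?E")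
proof (rule KB_convexI)
  fix x y a b :: real
  assume *: "0 < a" "a \<le> B" "0 < b" "b \<le> B" "y \<le> x"
  have "expectation (\<lambda>\<omega>. a * (\<phi> (y - X \<omega>) - \<phi> (y - b - X \<omega>)))
      \<le> expectation (\<lambda>\<omega>. b * (K + \<phi> (x + a - X \<omega>) - \<phi> (x - X \<omega>)))"
  proof (rule integral_mono)
    show "a * (\<phi> (y - X \<omega>) - \<phi> (y - b - X \<omega>))
        \<le> b * (K + \<phi> (x + a - X \<omega>) - \<phi> (x - X \<omega>))" for \<omega>
      using KB_convexD1[OF \<phi> *(1-4), of "y - X \<omega>" "x - X \<omega>"] *(5) by (simp add: algebra_simps)
  qed (use int in auto)
  then show "a * (?E y - ?E (y - b)) \<le> b * (K + ?E (x + a) - ?E x)"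
    using int by (simp add: prob_space)
next
  fix x y a :: real
  assume *: "0 < a" "a \<le> B" "y \<le> x"
  have "expectation (\<lambda>\<omega>. a * (K + \<phi> (y - X \<omega>) - \<phi> (y - B - X \<omega>)))
      \<le> expectation (\<lambda>\<omega>. B * (K + \<phi> (x + a - X \<omega>) - \<phi> (x - X \<omega>)))"
  proof (rule integral_mono)
    show "a * (K + \<phi> (y - X \<omega>) - \<phi> (y - B - X \<omega>))
        \<le> B * (K + \<phi> (x + a - X \<omega>) - \<phi> (x - X \<omega>))" for \<omega>
      using KB_convexD2[OF \<phi> *(1,2), of "y - X \<omega>" "x - X \<omega>"] *(3) by (simp add: algebra_simps)
  qed (use int in auto)
  then show "a * (K + ?E y - ?E (y - B)) \<le> B * (K + ?E (x + a) - ?E x)"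
    using int by (simp add: prob_space)
qed

end

section \<open>The inventory model\<close>

lemma min_G_eq_window_min: "min_G I n = window_min (capacity I) (cost_G I n)"
  by (simp add: fun_eq_iff min_G_def window_min_def)

text \<open>The objective jumps at \<open>y = x\<close>, where no fixed cost is charged, so its
  minimum is exhibited by hand: at \<open>x\<close> itself or at a minimiser \<open>z\<close> of
  \<open>cost_G\<close>. If the latter is strictly better, the positive fixed cost forces
  \<open>z\<close> to differ from \<open>x\<close>.\<close>

lemma opt_cost_eq_min:
  assumes cont: "continuous_on UNIV (cost_G I (Suc n))" and "0 < capacity I" "0 < fixed_cost I"
  shows "opt_cost I (Suc n) x =
    - unit_cost I * x + min (cost_G I (Suc n) x) (fixed_cost I + min_G I (Suc n) x)"
proof -
  let ?G = "cost_G I (Suc n)"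
  let ?cost = "\<lambda>y. (if y = x then 0 else fixed_cost I) - unit_cost I * x + ?G y"
  obtain z where z: "z \<in> {x..x + capacity I}" "min_G I (Suc n) x = ?G z"
    "\<And>y. y \<in> {x..x + capacity I} \<Longrightarrow> ?G z \<le> ?G y"
    using window_min_attained[OF cont, of "capacity I" x] \<open>0 < capacity I\<close>
    unfolding min_G_eq_window_min by (metis less_imp_le)
  have "opt_cost I (Suc n) x = (INF y\<in>{x..x + capacity I}. ?cost y)"
    unfolding opt_cost.simps
    by (rule INF_cong) (auto simp: cost_G_def order_cost_def algebra_simps)
  also have "\<dots> = - unit_cost I * x + min (?G x) (fixed_cost I + ?G z)"
  proof (rule cInf_eq_minimum)
    show "- unit_cost I * x + min (?G x) (fixed_cost I + ?G z) \<in> ?cost ` {x..x + capacity I}"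
    proof (cases "?G x \<le> fixed_cost I + ?G z")
      case True
      then show ?thesis
        using assms by (intro image_eqI[of _ _ x]) auto
    next
      case False
      then have "z \<noteq> x"
        using assms by auto
      with False z(1) show ?thesis
        by (intro image_eqI[of _ _ z]) auto
    qed
    fix c assume "c \<in> ?cost ` {x..x + capacity I}"
    then show "- unit_cost I * x + min (?G x) (fixed_cost I + ?G z) \<le> c"
      using z(3) by (auto simp: min_le_iff_disj)
  qed
  finally show ?thesis
    unfolding z(2) .
qed

section \<open>Costs as expectations over the demand\<close>

context inventory_model
begin

text \<open>The cost of ending a period with net stock \<open>u\<close>; the one-period cost is its
  mean at \<open>u = y - d n\<close>.\<close>

definition penalty :: "real \<Rightarrow> real" where
  "penalty u = holding_cost I * max u 0 + shortage_cost I * max (- u) 0"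

lemma KB_convex_penalty: "KB_convex 0 B penalty"
  unfolding penalty_def
  using holding_cost_pos shortage_cost_pos by (intro KB_convex_piecewise_linear) auto

lemma lipschitz_on_pos_part: "1-lipschitz_on UNIV (\<lambda>u::real. max u 0)"
  and lipschitz_on_neg_part: "1-lipschitz_on UNIV (\<lambda>u::real. max (- u) 0)"
  by (rule lipschitz_onI; auto simp: dist_real_def)+

lemma lipschitz_on_penalty: "(holding_cost I + shortage_cost I)-lipschitz_on UNIV penalty"
  using lipschitz_on_add[OF lipschitz_on_cmult_real_upper[OF lipschitz_on_pos_part]
      lipschitz_on_cmult_real_upper[OF lipschitz_on_neg_part]]
    holding_cost_pos shortage_cost_pos
  unfolding penalty_def[abs_def] by simp

lemma integral_density:
  assumes n: "n \<in> {1..N}" and g: "g \<in> borel_measurable borel"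
  shows "(LINT \<xi>|lborel. demand_density I n \<xi> * g \<xi>) = expectation (\<lambda>\<omega>. g (d n \<omega>))"
  by (rule distributed_integral[OF demand_distributed[OF n]]) (use g density_nonneg n in auto)

lemma period_cost_eq:
  assumes n: "n \<in> {1..N}"
  shows "period_cost I n y = expectation (\<lambda>\<omega>. penalty (y - d n \<omega>))"
proof -
  note int = integrable_lipschitz_shift[OF demand_finite_mean[OF n]]
  \<comment> \<open>As the density vanishes on the negative half-line, a positive part can replace
    the interval \<open>{0..y}\<close>; for \<open>y < 0\<close> both integrands are zero.\<close>
  have "(LBINT \<xi>:{0..y}. holding_cost I * (y - \<xi>) * demand_density I n \<xi>)
      = (LBINT \<xi>. demand_density I n \<xi> * (holding_cost I * max (y - \<xi>) 0))"
    unfolding set_lebesgue_integral_def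
    by (rule Bochner_Integration.integral_cong)
      (auto simp: indicator_def density_neg[OF n] not_le)
  also have "\<dots> = expectation (\<lambda>\<omega>. holding_cost I * max (y - d n \<omega>) 0)"
    by (rule integral_density[OF n]) simp
  finally have h: "(LBINT \<xi>:{0..y}. holding_cost I * (y - \<xi>) * demand_density I n \<xi>)
    = expectation (\<lambda>\<omega>. holding_cost I * max (y - d n \<omega>) 0)" .
  have "(LBINT \<xi>:{y..}. shortage_cost I * (\<xi> - y) * demand_density I n \<xi>)
      = (LBINT \<xi>. demand_density I n \<xi> * (shortage_cost I * max (- (y - \<xi>)) 0))"
    unfolding set_lebesgue_integral_def
    by (rule Bochner_Integration.integral_cong) (auto simp: indicator_def)
  also have "\<dots> = expectation (\<lambda>\<omega>. shortage_cost I * max (- (y - d n \<omega>)) 0)"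
    by (rule integral_density[OF n]) simp
  finally have p: "(LBINT \<xi>:{y..}. shortage_cost I * (\<xi> - y) * demand_density I n \<xi>)
    = expectation (\<lambda>\<omega>. shortage_cost I * max (- (y - d n \<omega>)) 0)" .
  show ?thesis
    unfolding period_cost_def h p penalty_def
    by (rule Bochner_Integration.integral_add[symmetric])
      (intro integrable_mult_right int[OF lipschitz_on_pos_part] int[OF lipschitz_on_neg_part])+
qed

text \<open>The Lipschitz bound makes the future cost measurable and integrable, so that the two
  expectations may be merged into one.\<close>

lemma cost_G_eq:
  assumes n: "n \<in> {1..N}" and C: "L-lipschitz_on UNIV (opt_cost I (n - 1))"
  shows "cost_G I n y =
    unit_cost I * y + expectation (\<lambda>\<omega>. penalty (y - d n \<omega>) + opt_cost I (n - 1) (y - d n \<omega>))"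
proof -
  note int = integrable_lipschitz_shift[OF demand_finite_mean[OF n]]
  have "(LBINT \<xi>:{0..}. opt_cost I (n - 1) (y - \<xi>) * demand_density I n \<xi>)
      = (LBINT \<xi>. demand_density I n \<xi> * opt_cost I (n - 1) (y - \<xi>))"
    unfolding set_lebesgue_integral_def
    by (rule Bochner_Integration.integral_cong)
      (auto simp: indicator_def density_neg[OF n] not_le)
  also have "\<dots> = expectation (\<lambda>\<omega>. opt_cost I (n - 1) (y - d n \<omega>))"
  proof (rule integral_density[OF n])
    have "continuous_on UNIV (opt_cost I (n - 1))"
      using C by (rule lipschitz_on_continuous_on)
    then have [measurable]: "opt_cost I (n - 1) \<in> borel_measurable borel"
      by (rule borel_measurable_continuous_onI)
    show "(\<lambda>\<xi>. opt_cost I (n - 1) (y - \<xi>)) \<in> borel_measurable borel"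
      by measurable
  qed
  finally show ?thesis
    unfolding cost_G_def period_cost_eq[OF n]
    using Bochner_Integration.integral_add[OF int[OF lipschitz_on_penalty] int[OF C]] by simp
qed

section \<open>Induction over the periods\<close>

text \<open>The penalty and the linear ordering cost have constant \<open>0\<close>, so adding them
  and averaging over the demand preserve the constant \<open>fixed_cost I\<close>.\<close>

lemma cost_G_regular:
  assumes n: "n \<in> {1..N}" and C: "L-lipschitz_on UNIV (opt_cost I (n - 1))"
    and conv: "KB_convex (fixed_cost I) (capacity I) (opt_cost I (n - 1))"
  shows "KB_convex (fixed_cost I) (capacity I) (cost_G I n)"
    and "\<exists>L'. L'-lipschitz_on UNIV (cost_G I n)"
proof -
  let ?\<phi> = "\<lambda>u. penalty u + opt_cost I (n - 1) u"
  have eq: "cost_G I n = (\<lambda>y. unit_cost I * y + expectation (\<lambda>\<omega>. ?\<phi> (y - d n \<omega>)))"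
    using cost_G_eq[OF n C] by blast
  have lip: "(holding_cost I + shortage_cost I + L)-lipschitz_on UNIV ?\<phi>"
    by (rule lipschitz_on_add[OF lipschitz_on_penalty C])
  have "KB_convex (fixed_cost I) (capacity I) ?\<phi>"
    using KB_convex_add[OF KB_convex_penalty conv] by simp
  then have "KB_convex (fixed_cost I) (capacity I) (\<lambda>y. expectation (\<lambda>\<omega>. ?\<phi> (y - d n \<omega>)))"
    by (rule KB_convex_expectation_shift[OF
          integrable_lipschitz_shift[OF demand_finite_mean[OF n] lip]])
  then show "KB_convex (fixed_cost I) (capacity I) (cost_G I n)"
    unfolding eq using KB_convex_add[OF KB_convex_linear[of _ "unit_cost I"]] by fastforce
  show "\<exists>L'. L'-lipschitz_on UNIV (cost_G I n)"
    unfolding eq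
    using lipschitz_on_add[OF lipschitz_on_linear
        lipschitz_on_expectation_shift[OF demand_finite_mean[OF n] lip]]
    by blast
qed

text \<open>The two properties are carried together: Lipschitz continuity supplies the finite
  expectations for \<open>cost_G_regular\<close> and the continuity for
  \<open>KB_convex_min_order\<close>. Its constant may change with \<open>n\<close>, hence the
  existential.\<close>

lemma opt_cost_regular:
  assumes "n \<le> N"
  shows "KB_convex (fixed_cost I) (capacity I) (opt_cost I n)
    \<and> (\<exists>L. L-lipschitz_on UNIV (opt_cost I n))"
  using assms
proof (induction n)
  case 0
  have "opt_cost I 0 = (\<lambda>x. 0)"
    by auto
  moreover have "0-lipschitz_on UNIV (\<lambda>x::real. 0::real)"
    by (rule lipschitz_onI) auto
  ultimately show ?case
    using KB_convex_const[of "fixed_cost I"] fixed_cost_pos by auto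
next
  case (Suc n)
  let ?K = "fixed_cost I" and ?B = "capacity I" and ?G = "cost_G I (Suc n)"
  obtain L where L: "L-lipschitz_on UNIV ?G" and G: "KB_convex ?K ?B ?G"
    using cost_G_regular[of "Suc n"] Suc by auto
  have cont: "continuous_on UNIV ?G"
    using L by (rule lipschitz_on_continuous_on)
  have eq: "opt_cost I (Suc n) =
      (\<lambda>x. - unit_cost I * x + min (?G x) (?K + window_min ?B ?G x))"
    using opt_cost_eq_min[OF cont capacity_pos fixed_cost_pos]
    unfolding min_G_eq_window_min by blast
  have "KB_convex ?K ?B (opt_cost I (Suc n))"
    unfolding eq
    using KB_convex_add[OF KB_convex_linear[of _ "- unit_cost I"]
        KB_convex_min_order[OF G cont capacity_pos fixed_cost_pos]]
    by simp
  moreover have "L-lipschitz_on UNIV (\<lambda>x. ?K + window_min ?B ?G x)"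
    using lipschitz_on_window_min[OF L, of ?B] capacity_pos by (simp add: lipschitz_on_def)
  then have "(\<bar>- unit_cost I\<bar> + L)-lipschitz_on UNIV (opt_cost I (Suc n))"
    unfolding eq by (intro lipschitz_on_add lipschitz_on_linear lipschitz_on_min L)
  ultimately show ?case
    by blast
qed

lemma
  assumes "n \<in> {1..N}"
  shows KB_convex_cost_G: "KB_convex (fixed_cost I) (capacity I) (cost_G I n)"
    and continuous_cost_G: "continuous_on UNIV (cost_G I n)"
proof -
  have "n - 1 \<le> N"
    using assms by auto
  then show "KB_convex (fixed_cost I) (capacity I) (cost_G I n)" "continuous_on UNIV (cost_G I n)"
    using opt_cost_regular cost_G_regular[OF assms] lipschitz_on_continuous_on by blast+
qed

section \<open>Order points and the four cases\<close>

text \<open>Up to the order point \<open>s\<close> the function \<open>cost_G I n\<close> is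
  antitone. The whole window of \<open>x\<close> lies there, so its right end is a minimiser, and
  the full order covers its fixed cost.\<close>

lemma full_order_optimal:
  assumes n: "n \<in> {1..N}" and s: "order_optimal I n s" and x: "x \<le> s - capacity I"
  shows "min_G I n x = cost_G I n (x + capacity I)" and "order_optimal I n x"
proof -
  let ?G = "cost_G I n" and ?B = "capacity I"
  note cont = continuous_cost_G[OF n]
  obtain z where z: "z \<in> {s..s + ?B}" "min_G I n s = ?G z"
    using window_min_attained[OF cont, of ?B s] capacity_pos
    unfolding min_G_eq_window_min by (metis less_imp_le)
  have le: "fixed_cost I + ?G z \<le> ?G s"
    using s z unfolding order_optimal_def by simp
  then have "z \<noteq> s"
    using fixed_cost_pos by auto
  then have c: "0 < z - s" "z - s \<le> ?B" "fixed_cost I + ?G (s + (z - s)) \<le> ?G s"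
    using z le by auto
  have "x + ?B \<le> s"
    using x by simp
  note below = KB_convex_below_order_point[OF KB_convex_cost_G[OF n] capacity_pos c this]
  show eq: "min_G I n x = ?G (x + ?B)"
    unfolding min_G_def
    by (rule cInf_eq_minimum) (use below(2) capacity_pos in auto)
  show "order_optimal I n x"
    unfolding order_optimal_def eq using below(1) by simp
qed

end

theorem lemma6:
  fixes M :: "'a measure" and d :: "nat \<Rightarrow> 'a \<Rightarrow> real" and I :: inventory
    and N n :: nat and s_m x :: real
  assumes "inventory_model M d I N"
    and "1 \<le> n" and "n \<le> N"
    and "is_max_order_level I n s_m"
  shows "(x < s_m - capacity I \<longrightarrow> opt_cost I n x = cost_GB I n x)
    \<and> (s_m - capacity I \<le> x \<and> ereal x < reorder_level I n \<longrightarrow> opt_cost I n x = cost_GS I n x)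
    \<and> (reorder_level I n \<le> ereal x \<and> x \<le> s_m \<longrightarrow>
         opt_cost I n x = min (- unit_cost I * x + cost_G I n x) (cost_GS I n x))
    \<and> (s_m < x \<longrightarrow> opt_cost I n x = - unit_cost I * x + cost_G I n x)"
proof -
  interpret inventory_model M d I N by fact
  have n: "n \<in> {1..N}"
    using assms by simp
  have C: "opt_cost I n x =
      - unit_cost I * x + min (cost_G I n x) (fixed_cost I + min_G I n x)"
    using opt_cost_eq_min[of I "n - 1" x] continuous_cost_G[OF n] capacity_pos fixed_cost_pos
      \<open>1 \<le> n\<close>
    by simp
  have s_m: "order_optimal I n s_m" "order_optimal I n x \<Longrightarrow> x \<le> s_m"
    using assms(4) unfolding is_max_order_level_def by auto
  have "opt_cost I n x = cost_GB I n x" if "x < s_m - capacity I"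
    using full_order_optimal[OF n s_m(1), of x] that C
    unfolding order_optimal_def cost_GB_def by simp
  moreover have "opt_cost I n x = cost_GS I n x" if "ereal x < reorder_level I n"
  proof -
    \<comment> \<open>The set in \<open>reorder_level\<close> consists of the levels where not
      ordering is optimal; strictly below its infimum ordering is strictly cheaper.\<close>
    have "\<not> 0 \<le> fixed_cost I + min_G I n x - cost_G I n x"
    proof
      assume "0 \<le> fixed_cost I + min_G I n x - cost_G I n x"
      then have "reorder_level I n \<le> ereal x"
        unfolding reorder_level_def by (intro Inf_lower) auto
      with that show False
        by simp
    qed
    then show ?thesis
      using C unfolding cost_GS_def by simp
  qed
  moreover have "opt_cost I n x = min (- unit_cost I * x + cost_G I n x) (cost_GS I n x)"
    using C unfolding cost_GS_def by (simp add: min_def)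
  moreover have "opt_cost I n x = - unit_cost I * x + cost_G I n x" if "s_m < x"
    using s_m(2) that C unfolding order_optimal_def by force
  ultimately show ?thesis
    by blast
qed

end
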